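(* Assume the dual of the current restricted master problem has a unique optimal solution $\pi_t^{\mathrm{out}}\in\mathbb{R}^m$, that $\mathcal Q_-(\pi_t^{\mathrm{out}})\neq\varnothing$, and that $\bar a := \sup_{q\in Q}\|A_q\|_2<\infty$. Let $\lambda_t>0$ be a constant such that $$b^\top\pi_t^{\mathrm{out}}-b^\top\pi\ \ge\ \lambda_t\,\|\pi-\pi_t^{\mathrm{out}}\|_2\qquad\text{for all }\pi\in D_R .$$ Let $\pi_t^{\mathrm{ref}}\in\mathbb{R}^m$ and $\varepsilon_t^-,\varepsilon_t^+\in\mathbb{R}^m$ with $\varepsilon_t^-,\varepsilon_t^+\ge 0$, and let $\pi_t^{\mathrm{sep}}$ be the stabilized dual produced by the penalization operator, i.e. the $\pi$-component of an optimal solution of $$\max_{\pi\in\mathbb{R}^m,\ w^-\in\mathbb{R}^m_+,\ w^+\in\mathbb{R}^m_+}\ b^\top\pi-(\varepsilon_t^-)^\top w^--(\varepsilon_t^+)^\top w^+\quad\text{s.t.}\quad A_R^\top\pi\le c_R,\ \ \pi-w^+\le\pi_t^{\mathrm{ref}},\ \ -\pi-w^-\le-\pi_t^{\mathrm{ref}}.$$ If $\pi_t^{\mathrm{ref}}=\pi_t^{\mathrm{out}}$, then the operator is neutral (it returns $\pi_t^{\mathrm{sep}}=\pi_t^{\mathrm{out}}$) and mispricing does not occur. Otherwise, let $\varepsilon_\infty=\max_i\{\varepsilon_{t,i}^-,\varepsilon_{t,i}^+\}$; if $$\varepsilon_\infty\ \le\ \frac{\lambda_t}{\sqrt m\,\|\pi_t^{\mathrm{out}}-\pi_t^{\mathrm{ref}}\|_2}\cdot\frac{\min\{\gamma_t^-,\gamma_t^+\}}{2\,\bar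 a},$$ then $r_{q(\pi_t^{\mathrm{sep}})}(\pi_t^{\mathrm{out}})<0$ (for every column $q(\pi_t^{\mathrm{sep}})$ that the exact pricing oracle may return at $\pi_t^{\mathrm{sep}}$) and mispricing is prevented.
   Context: Column generation setting. The master problem is the linear program $\min\{c^\top x : Ax=b,\ x\ge 0\}$ with $b\in\mathbb{R}^m$; $Q$ is the index set of all its columns, and column $q\in Q$ has coefficient vector $A_q\in\mathbb{R}^m$ and cost $c_q\in\mathbb{R}$. At iteration $t$ the restricted master problem (RMP) uses only the columns in a subset $R\subseteq Q$ (with matrix $A_R$ and cost vector $c_R$); its dual feasible set is $D_R=\{\pi\in\mathbb{R}^m: A_R^\top\pi\le c_R\}$, its dual is $\max\{b^\top\pi:\pi\in D_R\}$, and $\pi_t^{\mathrm{out}}$ denotes an optimal solution of that dual. (When the optimum is unique, a constant $\lambda_t>0$ as in the claim exists by a standard polyhedral error bound.) The reduced cost of column $q$ at $\pi\in\mathbb{R}^m$ is $r_q(\pi)=c_q-A_q^\top\pi$. The pricing problem at $\pi$ is $\sigma(\pi)=\min_{q\in Q}r_q(\pi)$; the pricing oracle is exact and returns a minimizer $q(\pi)\in\arg\min_{q\in Q}r_q(\pi)$. It is assumed that for every dual vector $\pi$ the pricing problem admits an optimal solution. In stabilized column generation, pricing is done at a stabilized dual $\pi_t^{\mathrm{sep}}$ instead of $\pi_t^{\mathrm{out}}$. Define $\mathcal Q_-(\pi_t^{\mathrm{out}})=\{q\in Q: r_q(\pi_t^{\mathrm{out}})<0\}$, $\mathcal Q_+(\pi_t^{\mathrm{out}})=\{q\in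 Q: r_q(\pi_t^{\mathrm{out}})\ge 0\}$, $\gamma_t^-=-\min_{q\in\mathcal Q_-(\pi_t^{\mathrm{out}})}r_q(\pi_t^{\mathrm{out}})$, and $\gamma_t^+=\min_{q\in\mathcal Q_+(\pi_t^{\mathrm{out}})}r_q(\pi_t^{\mathrm{out}})$, with $\gamma_t^+=+\infty$ if $\mathcal Q_+(\pi_t^{\mathrm{out}})=\varnothing$. Only iterations with $\mathcal Q_-(\pi_t^{\mathrm{out}})\ne\varnothing$ are considered. Mispricing: at iteration $t$, assuming $\sigma(\pi_t^{\mathrm{out}})<0$, a mispricing event occurs if the pricing oracle returns a column $q\in Q$ with $r_q(\pi_t^{\mathrm{out}})\ge 0$. *)

theory Defs
  imports "HOL-Analysis.Analysis"
begin

(* The columns of the master problem are the elements of an arbitrary (possibly infinite)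
   index set Q; column q has coefficient vector A q and cost c q.  The number m of rows
   is CARD('m). *)

definition reduced_cost ::
  "('q \<Rightarrow> real^'m) \<Rightarrow> ('q \<Rightarrow> real) \<Rightarrow> 'q \<Rightarrow> real^'m \<Rightarrow> real" where
  "reduced_cost A c q \<pi> = c q - A q \<bullet> \<pi>"

definition pricing_solutions ::
  "('q \<Rightarrow> real^'m) \<Rightarrow> ('q \<Rightarrow> real) \<Rightarrow> 'q set \<Rightarrow> real^'m \<Rightarrow> 'q set" where
  "pricing_solutions A c Q \<pi> = {q. is_arg_min (\<lambda>q. reduced_cost A c q \<pi>) (\<lambda>q. q \<in> Q) q}"

(* The infimum is a minimum whenever pricing_solutions A c Q \<pi> is nonempty. *)
definition pricing_value ::
  "('q \<Rightarrow> real^'m) \<Rightarrow> ('q \<Rightarrow> real) \<Rightarrow> 'q set \<Rightarrow> real^'m \<Rightarrow> real" where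
  "pricing_value A c Q \<pi> = (INF q\<in>Q. reduced_cost A c q \<pi>)"

definition dual_feasible ::
  "('q \<Rightarrow> real^'m) \<Rightarrow> ('q \<Rightarrow> real) \<Rightarrow> 'q set \<Rightarrow> (real^'m) set" where
  "dual_feasible A c R = {\<pi>. \<forall>q\<in>R. A q \<bullet> \<pi> \<le> c q}"

definition dual_solutions ::
  "real^'m \<Rightarrow> ('q \<Rightarrow> real^'m) \<Rightarrow> ('q \<Rightarrow> real) \<Rightarrow> 'q set \<Rightarrow> (real^'m) set" where
  "dual_solutions b A c R = {\<pi>. is_arg_max (\<lambda>\<pi>. b \<bullet> \<pi>) (\<lambda>\<pi>. \<pi> \<in> dual_feasible A c R) \<pi>}"

definition negative_columns ::
  "('q \<Rightarrow> real^'m) \<Rightarrow> ('q \<Rightarrow> real) \<Rightarrow> 'q set \<Rightarrow> real^'m \<Rightarrow> 'q set" where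
  "negative_columns A c Q \<pi> = {q \<in> Q. reduced_cost A c q \<pi> < 0}"

definition nonnegative_columns ::
  "('q \<Rightarrow> real^'m) \<Rightarrow> ('q \<Rightarrow> real) \<Rightarrow> 'q set \<Rightarrow> real^'m \<Rightarrow> 'q set" where
  "nonnegative_columns A c Q \<pi> = {q \<in> Q. reduced_cost A c q \<pi> \<ge> 0}"

(* If the pricing problem at \<pi> is solvable and there is a negative column, this infimum
   is attained, so it is the minimum. *)
definition gamma_minus ::
  "('q \<Rightarrow> real^'m) \<Rightarrow> ('q \<Rightarrow> real) \<Rightarrow> 'q set \<Rightarrow> real^'m \<Rightarrow> real" where
  "gamma_minus A c Q \<pi> = - (INF q\<in>negative_columns A c Q \<pi>. reduced_cost A c q \<pi>)"

(* The value is \<infinity> if there is no nonnegative column.  For infinite Q the minimum over the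
   nonnegative columns need not be attained; the infimum is taken in that case. *)
definition gamma_plus ::
  "('q \<Rightarrow> real^'m) \<Rightarrow> ('q \<Rightarrow> real) \<Rightarrow> 'q set \<Rightarrow> real^'m \<Rightarrow> ereal" where
  "gamma_plus A c Q \<pi> = (INF q\<in>nonnegative_columns A c Q \<pi>. ereal (reduced_cost A c q \<pi>))"

(* The event that pricing at some stabilized dual returns q while the out-point is \<pi>out. *)
definition mispricing ::
  "('q \<Rightarrow> real^'m) \<Rightarrow> ('q \<Rightarrow> real) \<Rightarrow> 'q set \<Rightarrow> real^'m \<Rightarrow> 'q \<Rightarrow> bool" where
  "mispricing A c Q \<pi>out q \<longleftrightarrow>
     pricing_value A c Q \<pi>out < 0 \<and> q \<in> Q \<and> reduced_cost A c q \<pi>out \<ge> 0"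

(* Vector inequalities are componentwise. *)
definition stabilized_feasible ::
  "('q \<Rightarrow> real^'m) \<Rightarrow> ('q \<Rightarrow> real) \<Rightarrow> 'q set \<Rightarrow> real^'m
     \<Rightarrow> ((real^'m) \<times> (real^'m) \<times> (real^'m)) set" where
  "stabilized_feasible A c R \<pi>ref =
     {(\<pi>, wm, wp). \<pi> \<in> dual_feasible A c R \<and> 0 \<le> wm \<and> 0 \<le> wp \<and>
        \<pi> - wp \<le> \<pi>ref \<and> - \<pi> - wm \<le> - \<pi>ref}"

definition stabilized_objective ::
  "real^'m \<Rightarrow> real^'m \<Rightarrow> real^'m \<Rightarrow> (real^'m) \<times> (real^'m) \<times> (real^'m) \<Rightarrow> real" where
  "stabilized_objective b \<epsilon>m \<epsilon>p = (\<lambda>(\<pi>, wm, wp). b \<bullet> \<pi> - \<epsilon>m \<bullet> wm - \<epsilon>p \<bullet> wp)"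

definition stabilized_duals ::
  "real^'m \<Rightarrow> ('q \<Rightarrow> real^'m) \<Rightarrow> ('q \<Rightarrow> real) \<Rightarrow> 'q set \<Rightarrow> real^'m \<Rightarrow> real^'m \<Rightarrow> real^'m
     \<Rightarrow> (real^'m) set" where
  "stabilized_duals b A c R \<pi>ref \<epsilon>m \<epsilon>p =
     {\<pi>. \<exists>wm wp. is_arg_max (stabilized_objective b \<epsilon>m \<epsilon>p)
            (\<lambda>z. z \<in> stabilized_feasible A c R \<pi>ref) (\<pi>, wm, wp)}"

end

theory Submission
  imports Defs
begin

text \<open>Optimality of the stabilized dual against the out-point, together with the error bound,
  bounds the distance between the two points by the penalty paid at the out-point, which is at most
  \<open>\<epsilon>inf * sqrt m * norm (\<pi>out - \<pi>ref)\<close>. Within distance \<open>min \<gamma>minus \<gamma>plus / (2 * abar)\<close> every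
  reduced cost changes by at most half of \<open>min \<gamma>minus \<gamma>plus\<close>, so the best column stays strictly
  below every nonnegative one.\<close>

text \<open>Cauchy-Schwarz against the all-ones vector, whose norm is \<open>sqrt m\<close>.\<close>

lemma sum_abs_le_sqrt_card_norm:
  fixes x :: "real^'m"
  shows "(\<Sum>i\<in>UNIV. \<bar>x $ i\<bar>) \<le> sqrt (real CARD('m)) * norm x"
  using L2_set_mult_ineq[of "\<lambda>i. 1" "\<lambda>i. x $ i" "UNIV :: 'm set"]
  by (simp add: L2_set_def norm_vec_def)

text \<open>In each coordinate at most one of the negative and positive parts of \<open>x\<close> is
  nonzero, so \<open>e\<close> multiplies \<bar>x_i\<bar> only once, without a factor 2.\<close>

lemma penalty_le:
  fixes \<epsilon>m \<epsilon>p x :: "real^'m"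
  assumes "\<And>i. \<epsilon>m $ i \<le> e" "\<And>i. \<epsilon>p $ i \<le> e" "0 \<le> e"
  shows "\<epsilon>m \<bullet> (\<chi> i. max 0 (- x $ i)) + \<epsilon>p \<bullet> (\<chi> i. max 0 (x $ i))
           \<le> e * (sqrt (real CARD('m)) * norm x)"
proof -
  have "\<epsilon>m \<bullet> (\<chi> i. max 0 (- x $ i)) + \<epsilon>p \<bullet> (\<chi> i. max 0 (x $ i))
      = (\<Sum>i\<in>UNIV. \<epsilon>m $ i * max 0 (- x $ i) + \<epsilon>p $ i * max 0 (x $ i))"
    by (simp add: inner_vec_def sum.distrib)
  also have "\<dots> \<le> (\<Sum>i\<in>UNIV. e * \<bar>x $ i\<bar>)"
  proof (rule sum_mono)
    fix i
    show "\<epsilon>m $ i * max 0 (- x $ i) + \<epsilon>p $ i * max 0 (x $ i) \<le> e * \<bar>x $ i\<bar>"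
      using mult_right_mono[OF assms(1)[of i], of "- x $ i"]
        mult_right_mono[OF assms(2)[of i], of "x $ i"]
      by (cases "x $ i \<ge> 0") (auto simp: max_def)
  qed
  also have "\<dots> = e * (\<Sum>i\<in>UNIV. \<bar>x $ i\<bar>)"
    by (simp add: sum_distrib_left)
  also have "\<dots> \<le> e * (sqrt (real CARD('m)) * norm x)"
    using sum_abs_le_sqrt_card_norm assms(3) by (rule mult_left_mono)
  finally show ?thesis .
qed

text \<open>This serves both cases of the theorem: the right-hand side vanishes when
  \<open>\<pi>ref = \<pi>out\<close>, and is small when the penalties are small.\<close>

lemma stabilized_dual_dist_le:
  fixes A :: "'q \<Rightarrow> real^'m"
  assumes out: "\<pi>out \<in> dual_feasible A c R"
    and bound: "\<And>\<pi>. \<pi> \<in> dual_feasible A c R \<Longrightarrow> b \<bullet> \<pi>out - b \<bullet> \<pi> \<ge> lam * norm (\<pi> - \<pi>out)"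
    and nonneg: "0 \<le> \<epsilon>m" "0 \<le> \<epsilon>p"
    and sep: "\<pi>sep \<in> stabilized_duals b A c R \<pi>ref \<epsilon>m \<epsilon>p"
    and e: "\<And>i. \<epsilon>m $ i \<le> e" "\<And>i. \<epsilon>p $ i \<le> e"
  shows "lam * norm (\<pi>sep - \<pi>out) \<le> e * (sqrt (real CARD('m)) * norm (\<pi>out - \<pi>ref))"
proof -
  define x where "x = \<pi>out - \<pi>ref"
  \<comment> \<open>The componentwise least slacks that make \<open>\<pi>out\<close> feasible for
    the penalized problem.\<close>
  define wm wp :: "real^'m" where "wm = (\<chi> i. max 0 (- x $ i))" and "wp = (\<chi> i. max 0 (x $ i))"
  from sep obtain vm vp where opt: "is_arg_max (stabilized_objective b \<epsilon>m \<epsilon>p)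
      (\<lambda>z. z \<in> stabilized_feasible A c R \<pi>ref) (\<pi>sep, vm, vp)"
    by (auto simp: stabilized_duals_def)
  then have feas: "\<pi>sep \<in> dual_feasible A c R" "0 \<le> vm" "0 \<le> vp"
    by (auto simp: is_arg_max_def stabilized_feasible_def)
  have "(\<pi>out, wm, wp) \<in> stabilized_feasible A c R \<pi>ref"
    using out by (auto simp: stabilized_feasible_def wm_def wp_def x_def less_eq_vec_def)
  with opt have "stabilized_objective b \<epsilon>m \<epsilon>p (\<pi>out, wm, wp)
      \<le> stabilized_objective b \<epsilon>m \<epsilon>p (\<pi>sep, vm, vp)"
    by (auto simp: is_arg_max_linorder)
  moreover have "0 \<le> \<epsilon>m \<bullet> vm" "0 \<le> \<epsilon>p \<bullet> vp"
    using nonneg feas by (auto simp: inner_vec_def less_eq_vec_def intro!: sum_nonneg)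
  ultimately have "b \<bullet> \<pi>out - b \<bullet> \<pi>sep \<le> \<epsilon>m \<bullet> wm + \<epsilon>p \<bullet> wp"
    by (simp add: stabilized_objective_def)
  \<comment> \<open>Here \<open>undefined\<close> is merely some index; any coordinate gives 0 \<le>
    \<epsilon>m_i \<le> e.\<close>
  moreover have "0 \<le> e"
    using nonneg(1) e(1)[of undefined] order_trans[of 0 "\<epsilon>m $ undefined" e]
    by (simp add: less_eq_vec_def)
  ultimately show ?thesis
    using penalty_le[OF e, of x] bound[OF feas(1)] by (simp add: wm_def wp_def x_def)
qed

lemma reduced_cost_diff_le:
  "\<bar>reduced_cost A c q \<pi> - reduced_cost A c q \<pi>'\<bar> \<le> norm (A q) * norm (\<pi> - \<pi>')"
proof -
  have "\<bar>reduced_cost A c q \<pi> - reduced_cost A c q \<pi>'\<bar> = \<bar>A q \<bullet> (\<pi> - \<pi>')\<bar>"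
    by (simp add: reduced_cost_def inner_diff_right abs_minus_commute)
  then show ?thesis
    using Cauchy_Schwarz_ineq2 by simp
qed

lemma pricing_solutions_iff:
  "q \<in> pricing_solutions A c Q \<pi> \<longleftrightarrow>
     q \<in> Q \<and> (\<forall>q'\<in>Q. reduced_cost A c q \<pi> \<le> reduced_cost A c q' \<pi>)"
  by (auto simp: pricing_solutions_def is_arg_min_linorder)

lemma pricing_solution_negative:
  assumes "q \<in> pricing_solutions A c Q \<pi>" "negative_columns A c Q \<pi> \<noteq> {}"
  shows "reduced_cost A c q \<pi> < 0"
  using assms by (fastforce simp: pricing_solutions_iff negative_columns_def)

text \<open>A minimizer over all of \<open>Q\<close> is itself a negative column, so the infimum
  over the negative columns is attained there.\<close>

lemma gamma_minus_eq:
  assumes "q \<in> pricing_solutions A c Q \<pi>" "negative_columns A c Q \<pi> \<noteq> {}"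
  shows "gamma_minus A c Q \<pi> = - reduced_cost A c q \<pi>"
proof -
  have "(INF q\<in>negative_columns A c Q \<pi>. reduced_cost A c q \<pi>) = reduced_cost A c q \<pi>"
    using assms pricing_solution_negative[OF assms]
    by (intro cInf_eq_minimum) (auto simp: pricing_solutions_iff negative_columns_def)
  then show ?thesis
    by (simp add: gamma_minus_def)
qed

lemma not_mispricing:
  "reduced_cost A c q \<pi> < 0 \<Longrightarrow> \<not> mispricing A c Q \<pi> q"
  by (simp add: mispricing_def)

theorem proposition2:
  fixes A :: "'q \<Rightarrow> real^'m" and c :: "'q \<Rightarrow> real" and b :: "real^'m"
    and Q R :: "'q set"
    and \<pi>out \<pi>ref \<pi>sep \<epsilon>m \<epsilon>p :: "real^'m"
    and lam abar \<epsilon>inf :: real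
  assumes "R \<subseteq> Q"
    and "\<And>\<pi>. pricing_solutions A c Q \<pi> \<noteq> {}"
    and "dual_solutions b A c R = {\<pi>out}"
    and "negative_columns A c Q \<pi>out \<noteq> {}"
    and "bdd_above ((\<lambda>q. norm (A q)) ` Q)"
    and "abar = (SUP q\<in>Q. norm (A q))"
    and "lam > 0"
    and "\<And>\<pi>. \<pi> \<in> dual_feasible A c R \<Longrightarrow> b \<bullet> \<pi>out - b \<bullet> \<pi> \<ge> lam * norm (\<pi> - \<pi>out)"
    and "0 \<le> \<epsilon>m" and "0 \<le> \<epsilon>p"
    and "\<pi>sep \<in> stabilized_duals b A c R \<pi>ref \<epsilon>m \<epsilon>p"
    and "\<epsilon>inf = Max (range (\<lambda>i. max (\<epsilon>m $ i) (\<epsilon>p $ i)))"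
  shows "(\<pi>ref = \<pi>out \<longrightarrow>
            \<pi>sep = \<pi>out \<and>
            (\<forall>q\<in>pricing_solutions A c Q \<pi>sep. \<not> mispricing A c Q \<pi>out q)) \<and>
         (\<pi>ref \<noteq> \<pi>out \<longrightarrow>
            ereal \<epsilon>inf \<le> ereal (lam / (sqrt (real CARD('m)) * norm (\<pi>out - \<pi>ref))) *
              (min (ereal (gamma_minus A c Q \<pi>out)) (gamma_plus A c Q \<pi>out) / ereal (2 * abar)) \<longrightarrow>
            (\<forall>q\<in>pricing_solutions A c Q \<pi>sep.
               reduced_cost A c q \<pi>out < 0 \<and> \<not> mispricing A c Q \<pi>out q))"
proof -
  have out: "\<pi>out \<in> dual_feasible A c R"
    using assms(3) by (auto simp: dual_solutions_def is_arg_max_def)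
  have e: "\<epsilon>m $ i \<le> \<epsilon>inf" "\<epsilon>p $ i \<le> \<epsilon>inf" for i
  proof -
    have "max (\<epsilon>m $ i) (\<epsilon>p $ i) \<le> \<epsilon>inf"
      unfolding assms(12) by (rule Max_ge) auto
    then show "\<epsilon>m $ i \<le> \<epsilon>inf" "\<epsilon>p $ i \<le> \<epsilon>inf" by auto
  qed
  have dist: "lam * norm (\<pi>sep - \<pi>out) \<le> \<epsilon>inf * (sqrt (real CARD('m)) * norm (\<pi>out - \<pi>ref))"
    using out assms(8-11) e by (rule stabilized_dual_dist_le)
  have neutral: "\<pi>sep = \<pi>out" if "\<pi>ref = \<pi>out"
    using dist that \<open>lam > 0\<close> by (simp add: mult_le_0_iff)
  have negative: "reduced_cost A c q \<pi>out < 0"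
    if ref: "\<pi>ref \<noteq> \<pi>out"
      and small: "ereal \<epsilon>inf \<le> ereal (lam / (sqrt (real CARD('m)) * norm (\<pi>out - \<pi>ref))) *
        (min (ereal (gamma_minus A c Q \<pi>out)) (gamma_plus A c Q \<pi>out) / ereal (2 * abar))"
      and q: "q \<in> pricing_solutions A c Q \<pi>sep" for q
  proof (rule ccontr)
    assume "\<not> reduced_cost A c q \<pi>out < 0"
    then have q_nonneg: "q \<in> nonnegative_columns A c Q \<pi>out" and "q \<in> Q"
      using q by (auto simp: nonnegative_columns_def pricing_solutions_iff)
    obtain p where p: "p \<in> pricing_solutions A c Q \<pi>out"
      using assms(2) by blast
    then have "p \<in> Q"
      by (simp add: pricing_solutions_iff)
    have p_neg: "reduced_cost A c p \<pi>out < 0"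
      using p assms(4) by (rule pricing_solution_negative)
    have gm: "gamma_minus A c Q \<pi>out = - reduced_cost A c p \<pi>out"
      using p assms(4) by (rule gamma_minus_eq)
    \<comment> \<open>The column \<open>q\<close> makes \<open>gamma_plus\<close> finite, so the
      extended-real hypothesis can be reduced to real arithmetic.\<close>
    have "gamma_plus A c Q \<pi>out \<le> ereal (reduced_cost A c q \<pi>out)"
      unfolding gamma_plus_def using q_nonneg by (rule INF_lower)
    moreover have "0 \<le> gamma_plus A c Q \<pi>out"
      unfolding gamma_plus_def by (rule INF_greatest) (auto simp: nonnegative_columns_def)
    ultimately obtain g where g: "gamma_plus A c Q \<pi>out = ereal g"
        "0 \<le> g" "g \<le> reduced_cost A c q \<pi>out"
      by (cases "gamma_plus A c Q \<pi>out") auto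
    define \<mu> where "\<mu> = min (gamma_minus A c Q \<pi>out) g"
    have abar: "norm (A q') \<le> abar" if "q' \<in> Q" for q'
      unfolding assms(6) using that assms(5) by (rule cSUP_upper)
    have "0 \<le> abar"
      using order_trans[OF norm_ge_zero abar[OF \<open>p \<in> Q\<close>]] .
    have "abar * norm (\<pi>sep - \<pi>out) \<le> \<mu> / 2"
    \<comment> \<open>For \<open>abar = 0\<close> the threshold in \<open>small\<close> divides by
      zero, so this case is argued directly: the left side is 0, and \<open>\<mu>\<close> is
      nonnegative because both arguments of its minimum are.\<close>
    proof (cases "abar = 0")
      case True
      then show ?thesis
        using g gm p_neg by (simp add: \<mu>_def)
    next
      case False
      define k where "k = sqrt (real CARD('m)) * norm (\<pi>out - \<pi>ref)"
      have "0 < abar" "0 < k"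
        using False \<open>0 \<le> abar\<close> ref by (auto simp: k_def)
      have "min (ereal (gamma_minus A c Q \<pi>out)) (gamma_plus A c Q \<pi>out) = ereal \<mu>"
        by (simp add: g \<mu>_def)
      with small have "\<epsilon>inf \<le> lam / k * (\<mu> / (2 * abar))"
        using \<open>0 < abar\<close> by (simp add: k_def)
      then have "\<epsilon>inf * k \<le> lam * (\<mu> / (2 * abar))"
        using \<open>0 < k\<close> \<open>0 < abar\<close> by (simp add: field_simps)
      \<comment> \<open>The factor \<open>k\<close> bounds the penalty in \<open>dist\<close> and
        divides the threshold in \<open>small\<close>, so it cancels.\<close>
      with dist have "lam * norm (\<pi>sep - \<pi>out) \<le> lam * (\<mu> / (2 * abar))"
        by (simp add: k_def)
      then have "norm (\<pi>sep - \<pi>out) \<le> \<mu> / (2 * abar)"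
        using \<open>lam > 0\<close> by (rule mult_left_le_imp_le)
      then show ?thesis
        using \<open>0 < abar\<close> by (simp add: field_simps)
    qed
    then have change: "\<bar>reduced_cost A c q' \<pi>sep - reduced_cost A c q' \<pi>out\<bar> \<le> \<mu> / 2"
      if "q' \<in> Q" for q'
      using reduced_cost_diff_le[of A c q' \<pi>sep \<pi>out]
        mult_right_mono[OF abar[OF that] norm_ge_zero[of "\<pi>sep - \<pi>out"]] by linarith
    have "reduced_cost A c q \<pi>sep \<le> reduced_cost A c p \<pi>sep"
      using q \<open>p \<in> Q\<close> by (simp add: pricing_solutions_iff)
    \<comment> \<open>From \<open>\<pi>out\<close> to \<open>\<pi>sep\<close>, \<open>q\<close>
      falls at most to g - \<mu>/2 and \<open>p\<close> rises at most to -\<open>gamma_minus\<close>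
      + \<mu>/2. Optimality of \<open>q\<close> then gives g + \<open>gamma_minus\<close> \<le>
      \<mu> \<le> g, contradicting \<open>gamma_minus\<close> > 0.\<close>
    then show False
      using change[OF \<open>p \<in> Q\<close>] change[OF \<open>q \<in> Q\<close>] g gm p_neg
      unfolding \<mu>_def by (simp add: min_def split: if_splits)
  qed
  show ?thesis
  proof (intro conjI impI ballI)
    fix q
    assume "\<pi>ref = \<pi>out" "q \<in> pricing_solutions A c Q \<pi>sep"
    \<comment> \<open>By neutrality \<open>q\<close> is priced at \<open>\<pi>out\<close> itself,
      where the minimum is negative.\<close>
    then show "\<not> mispricing A c Q \<pi>out q"
      using neutral pricing_solution_negative[OF _ assms(4)] by (simp add: not_mispricing)
  qed (simp_all only: neutral negative not_mispricing not_False_eq_True)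
qed

end
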